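(* Let $U=U(S_{\rm std},\mathcal{P}_{\rm std},F_4)$ be the two-dimensional Fourier walk acting on $\ell^2(\mathbb{Z}^2,\mathbb{C}^4)$. Then $U$ has no eigenvalues, i.e. its point spectrum is empty. Consequently, for every unit vector $\phi\in\mathbb{C}^4$ and every $x\in\mathbb{Z}^2$, $\lim_{n\to\infty}p_n(\phi;x)=0$.
   Context: Let $u_1,u_2$ be the standard basis of $\mathbb{Z}^2$ and $\mathbf{e}_1,\dots,\mathbf{e}_4$ the standard basis of $\mathbb{C}^4$; let $P_j$ denote the orthogonal projection onto $\mathbb{C}\mathbf{e}_j$. Set $S_{\rm std}=\{\pm u_1,\pm u_2\}$ and $\mathcal{P}_{\rm std}=\{P_\alpha\}_{\alpha\in S_{\rm std}}$ with $P_{u_j}=P_{2j-1}$, $P_{-u_j}=P_{2j}$. For $\alpha\in\mathbb{Z}^2$, $\tau^\alpha$ acts on $\ell^2(\mathbb{Z}^2,\mathbb{C}^4)$ by $(\tau^\alpha f)(x)=f(x-\alpha)$. For a $4\times 4$ unitary matrix $C$ (acting pointwise), $U(S_{\rm std},\mathcal{P}_{\rm std},C)=\big(\sum_{\alpha\in S_{\rm std}}\tau^\alpha P_\alpha\big)C$. $F_4$ is the discrete Fourier matrix $F_4=\frac12\big(q^{(j-1)(k-1)}\big)_{j,k=1}^4$ with $q=e^{2\pi i/4}=i$. For a unit vector $\phi\in\mathbb{C}^4$, $\delta_0\otimes\phi$ is the function equal to $\phi$ at $0$ and $0$ elsewhere, and $p_n(\phi;x)=\|U^n(\delta_0\otimes\phi)(x)\|_{\mathbb{C}^4}^2$.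 *)

theory Defs
  imports "HOL-Analysis.Analysis"
begin

type_synonym state = "int \<times> int \<Rightarrow> complex ^ 4"

definition l2 :: "state \<Rightarrow> bool" where
  "l2 f \<longleftrightarrow> (\<lambda>x. (norm (f x))\<^sup>2) summable_on UNIV"

definition shift :: "int \<times> int \<Rightarrow> state \<Rightarrow> state" where
  "shift a f = (\<lambda>x. f (fst x - fst a, snd x - snd a))"

definition proj :: "4 \<Rightarrow> complex ^ 4 \<Rightarrow> complex ^ 4" where
  "proj j v = (\<chi> k. if k = j then v $ k else 0)"

definition coin :: "complex ^ 4 ^ 4 \<Rightarrow> state \<Rightarrow> state" where
  "coin C f = (\<lambda>x. C *v f x)"

text \<open>U(S_std, P_std, C) = (sum_alpha tau^alpha P_alpha) C with
  P_{u1} = P_1, P_{-u1} = P_2, P_{u2} = P_3, P_{-u2} = P_4.\<close>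
definition walk :: "complex ^ 4 ^ 4 \<Rightarrow> state \<Rightarrow> state" where
  "walk C f = (let g = coin C f in
      (\<lambda>x. shift (1, 0) (\<lambda>y. proj 1 (g y)) x
         + shift (-1, 0) (\<lambda>y. proj 2 (g y)) x
         + shift (0, 1) (\<lambda>y. proj 3 (g y)) x
         + shift (0, -1) (\<lambda>y. proj 4 (g y)) x))"

text \<open>Discrete Fourier matrix F_4 = 1/2 (i^((j-1)(k-1))).\<close>
definition F4 :: "complex ^ 4 ^ 4" where
  "F4 = (1/2) *\<^sub>R vector [vector [1, 1, 1, 1],
                          vector [1, \<i>, -1, -\<i>],
                          vector [1, -1, 1, -1],
                          vector [1, -\<i>, -1, \<i>]]"

definition eigenvalue :: "(state \<Rightarrow> state) \<Rightarrow> complex \<Rightarrow> bool" where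
  "eigenvalue U c \<longleftrightarrow> (\<exists>f. l2 f \<and> f \<noteq> (\<lambda>_. 0) \<and> U f = (\<lambda>x. c *s f x))"

definition delta0 :: "complex ^ 4 \<Rightarrow> state" where
  "delta0 \<phi> = (\<lambda>x. if x = (0, 0) then \<phi> else 0)"

definition pn :: "(state \<Rightarrow> state) \<Rightarrow> nat \<Rightarrow> complex ^ 4 \<Rightarrow> int \<times> int \<Rightarrow> real" where
  "pn U n \<phi> x = (norm ((U ^^ n) (delta0 \<phi>) x))\<^sup>2"

end

theory Submission
  imports Defs "HOL-Library.Function_Algebras"
begin

text \<open>Write \<open>U\<close> for the walk and \<open>V\<close> for its inverse, and let \<open>x, y\<close> be the two unit shifts. Dividing
  the characteristic equation of \<open>U\<close> by \<open>U^2\<close> gives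
  \<open>p(U) = U^2 - i V^2 + e - t (U - V) = 0\<close> with scalar Laurent polynomials \<open>e, t\<close> in \<open>x, y\<close>.
  Commuting this with a coordinate multiplication \<open>X\<close> shows that \<open>[X, U] p'(U) + p_X(U)\<close> is a
  commutator \<open>[U, W]\<close>, where \<open>p_X\<close> is \<open>p\<close> with its coefficients replaced by their commutators
  with \<open>X\<close>. This telescopes to
  \<open>[X, U^n] p'(U) + n p_X(U) U^(n-1) = [U^n, W]\<close>. Every term but the one carrying the factor \<open>n\<close> is
  pointwise bounded on finitely supported states, so \<open>p_X(U) U^n f = O(1/n)\<close> pointwise.
  Eliminating \<open>U - V\<close> between the relations for the two coordinates leaves a scalar Laurent
  polynomial that is a product of factors \<open>1 - w a\<close> with \<open>w\<close> unimodular and \<open>a\<close> a nontrivial shift.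
  Such a factor can be cancelled: an \<open>l^2\<close>-bounded sequence that is asymptotically
  quasi-periodic along a line tends to \<open>0\<close> pointwise. So \<open>U^n f\<close> tends to \<open>0\<close> for finitely
  supported \<open>f\<close>, and approximating an eigenvector by such \<open>f\<close> excludes eigenvalues.\<close>

subsection \<open>The ring of additive endomorphisms\<close>

text \<open>Multiplication will be composition, so operator identities become ring identities open
  to \<open>algebra_simps\<close>. Requiring only additivity admits coordinate multiplications,
  which are unbounded in the \<open>l2\<close> norm.\<close>

typedef (overloaded) 'a endo = "{T :: 'a::ab_group_add \<Rightarrow> 'a. \<forall>f g. T (f + g) = T f + T g}"
  morphisms app Abs_endo
  by (rule exI[of _ "\<lambda>x. x"]) simp

setup_lifting type_definition_endo

lemma app_add: "app T (f + g) = app T f + app T g"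
  using app[of T] by simp

instantiation endo :: (ab_group_add) ring
begin
lift_definition zero_endo :: "'a endo" is "\<lambda>f. 0" by simp
lift_definition plus_endo :: "'a endo \<Rightarrow> 'a endo \<Rightarrow> 'a endo" is "\<lambda>S T f. S f + T f"
  by (simp add: algebra_simps)
lift_definition uminus_endo :: "'a endo \<Rightarrow> 'a endo" is "\<lambda>T f. - T f"
  by (simp add: algebra_simps)
lift_definition minus_endo :: "'a endo \<Rightarrow> 'a endo \<Rightarrow> 'a endo" is "\<lambda>S T f. S f - T f"
  by (simp add: algebra_simps)
lift_definition times_endo :: "'a endo \<Rightarrow> 'a endo \<Rightarrow> 'a endo" is "\<lambda>S T f. S (T f)"
  by simp
instance
  by (standard; transfer) (auto simp: algebra_simps)
end

instantiation endo :: (ab_group_add) monoid_mult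
begin
lift_definition one_endo :: "'a endo" is "\<lambda>f. f" by simp
instance by (standard; transfer) auto
end

subsection \<open>The telescoping commutator identity\<close>

lemma comm_left:
  fixes a :: "'a::ring"
  assumes "a * b = b * a" shows "a * (b * z) = b * (a * z)"
  using assms by (metis mult.assoc)

lemma comm_inverse:
  fixes a :: "'a::{ring,monoid_mult}"
  assumes "U * V = 1" "V * U = 1" "a * U = U * a" shows "a * V = V * a"
proof -
  have "a * V = V * (U * a) * V" using assms by (simp flip: mult.assoc)
  also have "\<dots> = V * a" using assms by (simp add: mult.assoc flip: assms(3))
  finally show ?thesis .
qed

text \<open>The coefficients \<open>j\<close>, \<open>e\<close>, \<open>t\<close> commute with
  \<open>U\<close>; \<open>j\<close> also commutes with \<open>X\<close>, while \<open>de\<close>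
  and \<open>dt\<close> are the commutators of \<open>X\<close> with \<open>e\<close> and
  \<open>t\<close>.\<close>

locale inverse_pair_relation =
  fixes U V X j e t de dt :: "'a::{ring,monoid_mult}"
  assumes UV: "U * V = 1" and VU: "V * U = 1"
    and Xj: "X * j = j * X" and Xe: "X * e = e * X + de" and Xt: "X * t = t * X + dt"
    and j: "j * U = U * j" and e: "e * U = U * e" and t: "t * U = U * t"
    and de: "de * U = U * de" and dt: "dt * U = U * dt"
    and rel: "U * U - j * (V * V) + e - t * (U - V) = 0"
begin

text \<open>With \<open>p(z) = z^2 - j z^(-2) + e - t (z - z^(-1))\<close>, \<open>dp\<close> is the derivative \<open>p'(U)\<close>, and \<open>px\<close> is
  \<open>p(U)\<close> with each coefficient replaced by its commutator with \<open>X\<close>.\<close>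

definition B where "B = X * U - U * X"

text \<open>Collects the corrections from moving \<open>B\<close> to the front of each monomial: for
  instance \<open>B * V * V - V * B * V\<close> is the commutator of \<open>U\<close> with
  \<open>V * B * V * V\<close>.\<close>

definition W where
  "W = j * (V * B * V * V * V + V * B * V * V * V + V * V * B * V * V) - B - t * (V * B * V * V)"

definition dp where "dp = U + U + j * (V * V * V) + j * (V * V * V) - t * (1 + V * V)"

definition px where "px = de - dt * (U - V)"

lemma cancel: "U * (V * z) = z" "V * (U * z) = z"
  by (simp_all add: UV VU flip: mult.assoc)

lemma V_comm: "j * V = V * j" "e * V = V * e" "t * V = V * t" "de * V = V * de" "dt * V = V * dt"
  by (rule comm_inverse[OF UV VU], rule j e t de dt)+

text \<open>Jacobi identity: since \<open>t\<close> commutes with \<open>U\<close>, the commutator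
  of \<open>B\<close> with \<open>t\<close> equals that of \<open>dt\<close> with \<open>U\<close>,
  which vanishes. For \<open>j\<close> the inner commutator is already zero.\<close>

lemma B_comm: "B * j = j * B" "B * t = t * B"
proof -
  show "B * j = j * B"
    by (simp add: B_def algebra_simps Xj j[symmetric] comm_left[OF j[symmetric]] comm_left[OF Xj])
  have "X * (t * z) = t * (X * z) + dt * z" for z
    using Xt by (metis distrib_right mult.assoc)
  thus "B * t = t * B"
    by (simp add: B_def algebra_simps Xt t[symmetric] comm_left[OF t[symmetric]] dt)
qed

text \<open>Rewriting towards a normal form: coefficients move left past the operators, and adjacent
  \<open>U\<close>, \<open>V\<close> cancel.\<close>

lemmas reorder = UV VU cancel
  Xj comm_left[OF Xj] B_comm[THEN comm_left] B_comm Xe Xt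
  j[symmetric] e[symmetric] t[symmetric] de[symmetric] dt[symmetric] V_comm[symmetric]
  j[symmetric, THEN comm_left] t[symmetric, THEN comm_left] dt[symmetric, THEN comm_left]
  V_comm(1,3,5)[symmetric, THEN comm_left]

lemma px_comm: "px * U = U * px"
  by (simp add: px_def algebra_simps reorder)

lemma commutator_one: "B * dp + px = U * W - W * U"
proof -
  have XU: "X * U = U * X + B" by (simp add: B_def)
  \<comment> \<open>The derivative of an inverse: bracketing with \<open>X\<close> is a
    derivation.\<close>
  have XV: "X * V = V * X - V * (B * V)"
    by (simp add: B_def algebra_simps UV VU cancel)
  have XUz: "X * (U * z) = U * (X * z) + B * z" for z
    by (metis XU distrib_right mult.assoc)
  have XVz: "X * (V * z) = V * (X * z) - V * (B * (V * z))" for z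
    by (metis XV left_diff_distrib mult.assoc)
  have Xtz: "X * (t * z) = t * (X * z) + dt * z" for z
    using Xt by (metis distrib_right mult.assoc)
  let ?P = "U * U - j * (V * V) + e - t * (U - V)"
  \<comment> \<open>By the product rule the differentiated coefficients make up \<open>px\<close>;
    every other monomial contains exactly one \<open>B\<close>.\<close>
  have "0 = X * ?P - ?P * X"
    by (simp add: rel)
  also have "\<dots> = B * U + U * B + j * (V * B * V * V + V * V * B * V)
      - t * (B + V * B * V) + px"
    by (simp add: px_def algebra_simps reorder XU XV XUz XVz Xtz)
  finally have "px = t * (B + V * B * V) - (B * U + U * B + j * (V * B * V * V + V * V * B * V))"
    by (simp add: algebra_simps eq_neg_iff_add_eq_0)
  thus ?thesis
    by (simp add: W_def dp_def algebra_simps reorder)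
qed

text \<open>The sum has equal summands; it stands for the multiple \<open>(n + 1) px U^n\<close>.\<close>

lemma commutator_power:
  "(X * U ^ Suc n - U ^ Suc n * X) * dp + (\<Sum>k\<le>n. px * U ^ n) = U ^ Suc n * W - W * U ^ Suc n"
proof (induction n)
  case 0
  show ?case using commutator_one by (simp add: B_def)
next
  case (Suc n)
  let ?D = "X * U ^ Suc n - U ^ Suc n * X"
  have pxn: "px * U ^ k = U ^ k * px" for k
    by (induction k) (simp_all add: px_comm[THEN comm_left] mult.assoc)
  have D: "X * U ^ Suc (Suc n) - U ^ Suc (Suc n) * X = ?D * U + U ^ Suc n * B"
    by (simp add: B_def algebra_simps power_Suc2 del: power_Suc)
  have dpU: "dp * U = U * dp"
    by (simp add: dp_def algebra_simps reorder)
  \<comment> \<open>Multiply the identity for \<open>n\<close> by \<open>U\<close> on the right and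
    \<open>commutator_one\<close> by \<open>U ^ Suc n\<close> on the left; in the sum of the
    right-hand sides the terms \<open>U ^ Suc n * W * U\<close> cancel.\<close>
  have "(X * U ^ Suc (Suc n) - U ^ Suc (Suc n) * X) * dp + (\<Sum>k\<le>Suc n. px * U ^ Suc n)
     = (?D * dp + (\<Sum>k\<le>n. px * U ^ n)) * U + U ^ Suc n * (B * dp + px)"
    unfolding D
    by (simp add: algebra_simps dpU dpU[THEN comm_left] sum_distrib_right
        px_comm px_comm[THEN comm_left] pxn pxn[THEN comm_left]
        power_commutes[THEN comm_left] power_commutes)
  also have "\<dots> = (U ^ Suc n * W - W * U ^ Suc n) * U + U ^ Suc n * (U * W - W * U)"
    by (simp only: Suc commutator_one)
  also have "\<dots> = U ^ Suc (Suc n) * W - W * U ^ Suc (Suc n)"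
    by (simp add: algebra_simps power_Suc2 del: power_Suc)
  finally show ?case .
qed

end

subsection \<open>The characteristic equation of the Fourier walk\<close>

lemma vector_4:
  "vector [w, x, y, z] $ (1 :: 4) = w" "vector [w, x, y, z] $ (2 :: 4) = x"
  "vector [w, x, y, z] $ (3 :: 4) = y" "vector [w, x, y, z] $ (4 :: 4) = z"
  by (simp_all add: vector_def)

lemma norm_vec4_le: "norm (v :: complex ^ 4) \<le> norm (v $ 1) + norm (v $ 2) + norm (v $ 3) + norm (v $ 4)"
  unfolding norm_vec_def by (rule order_trans[OF L2_set_le_sum]) (simp_all add: sum_4)

lemma norm_vec4_sq: "(norm (v :: complex ^ 4))\<^sup>2 = (cmod (v $ 1))\<^sup>2 + (cmod (v $ 2))\<^sup>2 + (cmod (v $ 3))\<^sup>2 + (cmod (v $ 4))\<^sup>2"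
  by (simp add: norm_vec_def L2_set_def sum_nonneg sum_4)

lemma F4_mult:
  "(F4 *v v) $ 1 = (v $ 1 + v $ 2 + v $ 3 + v $ 4) / 2"
  "(F4 *v v) $ 2 = (v $ 1 + \<i> * v $ 2 - v $ 3 - \<i> * v $ 4) / 2"
  "(F4 *v v) $ 3 = (v $ 1 - v $ 2 + v $ 3 - v $ 4) / 2"
  "(F4 *v v) $ 4 = (v $ 1 - \<i> * v $ 2 - v $ 3 + \<i> * v $ 4) / 2"
  by (simp_all add: vector_4 F4_def matrix_vector_mult_def sum_4 field_simps scaleR_conv_of_real[where 'a=complex])

text \<open>Two parallelogram stages, as in a fast Fourier transform: entries 1, 3 and 2, 4 are
  paired first, then their sums and differences.\<close>

lemma norm_F4_mult: "norm (F4 *v v) = norm v"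
proof -
  have parallelogram: "(cmod (x + y))\<^sup>2 + (cmod (x - y))\<^sup>2 = 2 * (cmod x)\<^sup>2 + 2 * (cmod y)\<^sup>2" for x y
    unfolding cmod_power2 by (simp add: power2_eq_square algebra_simps)
  have "4 * (norm (F4 *v v))\<^sup>2 = (cmod ((v $ 1 + v $ 3) + (v $ 2 + v $ 4)))\<^sup>2 + (cmod ((v $ 1 + v $ 3) - (v $ 2 + v $ 4)))\<^sup>2
     + ((cmod ((v $ 1 - v $ 3) + \<i> * (v $ 2 - v $ 4)))\<^sup>2 + (cmod ((v $ 1 - v $ 3) - \<i> * (v $ 2 - v $ 4)))\<^sup>2)"
    unfolding norm_vec4_sq F4_mult by (simp add: norm_divide power_divide) (simp add: algebra_simps)
  also have "\<dots> = 2 * ((cmod (v $ 1 + v $ 3))\<^sup>2 + (cmod (v $ 1 - v $ 3))\<^sup>2)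
      + 2 * ((cmod (v $ 2 + v $ 4))\<^sup>2 + (cmod (v $ 2 - v $ 4))\<^sup>2)"
    unfolding parallelogram[of "_ + _" "_ + _"] parallelogram[of "_ - _" "\<i> * _"]
    by (simp add: norm_mult)
  also have "\<dots> = 4 * (norm v)\<^sup>2"
    unfolding parallelogram norm_vec4_sq by simp
  finally show ?thesis by simp
qed

section \<open>The walk, its inverse, shifts and coordinates as ring elements\<close>

lemma walk_apply:
  "walk C f (a, b) $ 1 = (C *v f (a - 1, b)) $ 1"
  "walk C f (a, b) $ 2 = (C *v f (a + 1, b)) $ 2"
  "walk C f (a, b) $ 3 = (C *v f (a, b - 1)) $ 3"
  "walk C f (a, b) $ 4 = (C *v f (a, b + 1)) $ 4"
  by (simp_all add: walk_def shift_def proj_def coin_def Let_def)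

lift_definition step :: "state endo" is "walk F4"
  by (auto simp: fun_eq_iff vec_eq_iff forall_4 walk_apply matrix_vector_right_distrib)

lemma step_apply:
  "app step f (a, b) $ 1 = (f (a - 1, b) $ 1 + f (a - 1, b) $ 2 + f (a - 1, b) $ 3 + f (a - 1, b) $ 4) / 2"
  "app step f (a, b) $ 2 = (f (a + 1, b) $ 1 + \<i> * f (a + 1, b) $ 2 - f (a + 1, b) $ 3 - \<i> * f (a + 1, b) $ 4) / 2"
  "app step f (a, b) $ 3 = (f (a, b - 1) $ 1 - f (a, b - 1) $ 2 + f (a, b - 1) $ 3 - f (a, b - 1) $ 4) / 2"
  "app step f (a, b) $ 4 = (f (a, b + 1) $ 1 - \<i> * f (a, b + 1) $ 2 - f (a, b + 1) $ 3 + \<i> * f (a, b + 1) $ 4) / 2"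
  by (simp_all add: step.rep_eq walk_apply F4_mult)

text \<open>Undoes the shifts, then applies the adjoint of \<open>F4\<close>.\<close>

lift_definition unstep :: "state endo" is
  "\<lambda>f (a, b). vector
    [(f (a + 1, b) $ 1 + f (a - 1, b) $ 2 + f (a, b + 1) $ 3 + f (a, b - 1) $ 4) / 2,
     (f (a + 1, b) $ 1 - \<i> * f (a - 1, b) $ 2 - f (a, b + 1) $ 3 + \<i> * f (a, b - 1) $ 4) / 2,
     (f (a + 1, b) $ 1 - f (a - 1, b) $ 2 + f (a, b + 1) $ 3 - f (a, b - 1) $ 4) / 2,
     (f (a + 1, b) $ 1 + \<i> * f (a - 1, b) $ 2 - f (a, b + 1) $ 3 - \<i> * f (a, b - 1) $ 4) / 2]"
  by (auto simp: fun_eq_iff vec_eq_iff forall_4 vector_4 field_simps)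

lemma unstep_apply:
  "app unstep f (a, b) $ 1 = (f (a + 1, b) $ 1 + f (a - 1, b) $ 2 + f (a, b + 1) $ 3 + f (a, b - 1) $ 4) / 2"
  "app unstep f (a, b) $ 2 = (f (a + 1, b) $ 1 - \<i> * f (a - 1, b) $ 2 - f (a, b + 1) $ 3 + \<i> * f (a, b - 1) $ 4) / 2"
  "app unstep f (a, b) $ 3 = (f (a + 1, b) $ 1 - f (a - 1, b) $ 2 + f (a, b + 1) $ 3 - f (a, b - 1) $ 4) / 2"
  "app unstep f (a, b) $ 4 = (f (a + 1, b) $ 1 + \<i> * f (a - 1, b) $ 2 - f (a, b + 1) $ 3 - \<i> * f (a, b - 1) $ 4) / 2"
  by (simp_all add: unstep.rep_eq vector_4)

text \<open>A Laurent monomial; sums of these are the scalar coefficients of the characteristic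
  equation.\<close>

lift_definition wshift :: "complex \<Rightarrow> int \<times> int \<Rightarrow> state endo" is
  "\<lambda>c a f x. c *s f (x - a)"
  by (simp add: fun_eq_iff vector_add_ldistrib)

lift_definition position :: "(int \<times> int \<Rightarrow> complex) \<Rightarrow> state endo" is
  "\<lambda>\<xi> f x. \<xi> x *s f x"
  by (simp add: fun_eq_iff vector_add_ldistrib)

lemma endo_eqI: "(\<And>f a b. app S f (a, b) = app T f (a, b)) \<Longrightarrow> S = T" for S T :: "state endo"
  by (metis app_inject ext surj_pair)

lemma wshift_mult: "wshift c a * wshift d b = wshift (c * d) (a + b)"
  by transfer (auto simp: fun_eq_iff algebra_simps)

lemma wshift_0: "wshift 0 a = 0"
  by transfer (auto simp: fun_eq_iff)

lemma wshift_uminus: "- wshift c a = wshift (- c) a"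
  by transfer (auto simp: fun_eq_iff)

text \<open>An additive \<open>\<xi>\<close> acts as a derivation, multiplying the coefficient of
  each monomial by the value of \<open>\<xi>\<close> at its exponent.\<close>

lemma position_wshift:
  assumes "\<And>x y. \<xi> (x + y) = \<xi> x + \<xi> y"
  shows "position \<xi> * wshift c a = wshift c a * position \<xi> + wshift (\<xi> a * c) a"
proof -
  have "\<xi> x = \<xi> (x - a) + \<xi> a" for x
    using assms[of "x - a" a] by simp
  hence "\<xi> x *s (c *s v) = c *s (\<xi> (x - a) *s v) + (\<xi> a * c) *s v" for x and v :: "complex ^ 4"
    by (metis mult.commute vector_sadd_rdistrib vector_smult_assoc)
  hence "app (position \<xi> * wshift c a) = app (wshift c a * position \<xi> + wshift (\<xi> a * c) a)"
    unfolding times_endo.rep_eq plus_endo.rep_eq wshift.rep_eq position.rep_eq fun_eq_iff plus_fun_def by blast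
  thus ?thesis
    by (simp only: app_inject)
qed

lemma wshift_step: "wshift c a * step = step * wshift c a"
  by (rule endo_eqI, cases a)
     (simp add: times_endo.rep_eq wshift.rep_eq vec_eq_iff forall_4 step_apply field_simps)

lemma step_unstep: "step * unstep = 1"
  by (rule endo_eqI)
     (simp add: times_endo.rep_eq one_endo.rep_eq vec_eq_iff forall_4 step_apply unstep_apply add_divide_distrib diff_divide_distrib algebra_simps)

lemma unstep_step: "unstep * step = 1"
  by (rule endo_eqI)
     (simp add: times_endo.rep_eq one_endo.rep_eq vec_eq_iff forall_4 step_apply unstep_apply field_simps)

text \<open>\<open>walk_tr\<close> and \<open>walk_e2\<close> are the trace and the second elementary symmetric function of the
  symbol of the walk. The third one is minus the trace, and the determinant is \<open>-i\<close>.\<close>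

definition walk_e2 where
  "walk_e2 = wshift ((\<i> - 1) / 2) (0, 0) + wshift ((\<i> - 1) / 4) (1, -1) + wshift ((\<i> - 1) / 4) (-1, 1)"

definition walk_tr where
  "walk_tr = wshift (1 / 2) (1, 0) + wshift (\<i> / 2) (-1, 0) + wshift (1 / 2) (0, 1) + wshift (\<i> / 2) (0, -1)"

text \<open>Cayley-Hamilton for the 4 by 4 symbol, divided by its square; at each site it is a
  finite identity in every component.\<close>

lemma char_poly: "step * step - wshift \<i> (0, 0) * (unstep * unstep) + walk_e2 - walk_tr * (step - unstep) = 0"
  by (rule endo_eqI)
     (simp add: walk_e2_def walk_tr_def times_endo.rep_eq wshift.rep_eq plus_endo.rep_eq minus_endo.rep_eq zero_endo.rep_eq
       vec_eq_iff forall_4 step_apply unstep_apply field_simps)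

lemma inverse_pair_relation_walk:
  assumes "\<And>x y. \<xi> (x + y) = \<xi> x + \<xi> y"
  defines "c \<equiv> (\<i> - 1) / 4"
  shows "inverse_pair_relation step unstep (position \<xi>) (wshift \<i> (0, 0)) walk_e2 walk_tr
    (wshift (\<xi> (1, -1) * c) (1, -1) + wshift (\<xi> (-1, 1) * c) (-1, 1))
    (wshift (\<xi> (1, 0) / 2) (1, 0) + wshift (\<xi> (-1, 0) * \<i> / 2) (-1, 0)
      + wshift (\<xi> (0, 1) / 2) (0, 1) + wshift (\<xi> (0, -1) * \<i> / 2) (0, -1))"
proof -
  \<comment> \<open>Hence constant monomials commute with \<open>position \<xi>\<close>: the one in
    \<open>walk_e2\<close> leaves no trace in \<open>de\<close>.\<close>
  have 0: "\<xi> (0, 0) = 0" using assms(1)[of "(0, 0)" "(0, 0)"] by simp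
  show ?thesis
  proof
    show "step * step - wshift \<i> (0, 0) * (unstep * unstep) + walk_e2 - walk_tr * (step - unstep) = 0" by (rule char_poly)
  qed (simp_all add: step_unstep unstep_step wshift_step walk_e2_def walk_tr_def algebra_simps position_wshift assms wshift_0 0)
qed

subsection \<open>Pointwise decay\<close>

lemma norm_smult: "norm (c *s v) = cmod c * norm (v :: complex ^ 4)"
  by (simp add: norm_vec_def norm_mult L2_set_right_distrib)

lemma app_simps:
  "app (S + T) f = app S f + app T f" "app (S - T) f = app S f - app T f"
  "app (S * T) f = app S (app T f)" "app 1 f = f" "app 0 f = 0"
  by (simp_all add: plus_endo.rep_eq minus_endo.rep_eq times_endo.rep_eq one_endo.rep_eq zero_endo.rep_eq)

lemma app_sum: "app (\<Sum>k\<in>A. T k) f = (\<Sum>k\<in>A. app (T k) f)"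
  by (induction A rule: infinite_finite_induct) (simp_all add: app_simps)

text \<open>The constant may depend on the site, since a bound uniform in \<open>x\<close> would not
  survive multiplication by a coordinate.\<close>

definition bigo :: "(nat \<Rightarrow> real) \<Rightarrow> (nat \<Rightarrow> state) \<Rightarrow> bool" where
  "bigo r s \<longleftrightarrow> (\<forall>x. \<exists>B. \<forall>n. norm (s n x) \<le> B * r n)"

text \<open>Two consequences of finite range, chosen because they hold for \<open>position\<close>
  as well.\<close>

definition is_local :: "state endo \<Rightarrow> bool" where
  "is_local T \<longleftrightarrow> (\<forall>f. finite {x. f x \<noteq> 0} \<longrightarrow> finite {x. app T f x \<noteq> 0})
     \<and> (\<forall>r s. bigo r s \<longrightarrow> bigo r (\<lambda>n. app T (s n)))"

lemma bigo_add:
  assumes "bigo r s" "bigo r t" shows "bigo r (\<lambda>n. s n + t n)"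
  unfolding bigo_def
proof
  fix x
  obtain B C where "\<And>n. norm (s n x) \<le> B * r n" "\<And>n. norm (t n x) \<le> C * r n"
    using assms by (metis bigo_def)
  hence "norm ((s n + t n) x) \<le> (B + C) * r n" for n
    unfolding plus_fun_def distrib_right by (rule norm_triangle_mono)
  thus "\<exists>B. \<forall>n. norm ((s n + t n) x) \<le> B * r n" by blast
qed

lemma bigo_uminus: "bigo r s \<Longrightarrow> bigo r (\<lambda>n. - s n)"
  by (simp add: bigo_def)

lemma bigo_diff: "bigo r s \<Longrightarrow> bigo r t \<Longrightarrow> bigo r (\<lambda>n. s n - t n)"
  using bigo_add[OF _ bigo_uminus] by fastforce

lemma is_localI:
  assumes S: "finite S" and K: "K \<ge> 0"
    and bound: "\<And>f x. norm (app T f x) \<le> K * (\<Sum>a\<in>S. norm (f (x + a)))"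
  shows "is_local T"
  unfolding is_local_def
proof (intro conjI allI impI)
  fix f :: state
  assume f: "finite {x. f x \<noteq> 0}"
  have "{x. app T f x \<noteq> 0} \<subseteq> (\<Union>a\<in>S. (\<lambda>y. y - a) ` {y. f y \<noteq> 0})"
  proof
    fix x assume "x \<in> {x. app T f x \<noteq> 0}"
    hence "0 < K * (\<Sum>a\<in>S. norm (f (x + a)))"
      using bound[of f x] by (simp add: less_le_trans[of 0 "norm _"])
    hence "(\<Sum>a\<in>S. norm (f (x + a))) \<noteq> 0" by fastforce
    hence "\<not> (\<forall>a\<in>S. f (x + a) = 0)"
      using sum.neutral[of S "\<lambda>a. norm (f (x + a))"] by fastforce
    then obtain a where "a \<in> S" "f (x + a) \<noteq> 0" by blast
    moreover have "x = x + a - a" by simp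
    ultimately show "x \<in> (\<Union>a\<in>S. (\<lambda>y. y - a) ` {y. f y \<noteq> 0})"
      by blast
  qed
  thus "finite {x. app T f x \<noteq> 0}"
    by (rule finite_subset) (use S f in auto)
next
  fix r :: "nat \<Rightarrow> real" and s :: "nat \<Rightarrow> state"
  assume "bigo r s"
  then obtain B where B: "\<And>x n. norm (s n x) \<le> B x * r n"
    unfolding bigo_def by metis
  have "norm (app T (s n) x) \<le> (K * (\<Sum>a\<in>S. B (x + a))) * r n" for n x
  proof -
    have "norm (app T (s n) x) \<le> K * (\<Sum>a\<in>S. B (x + a) * r n)"
      by (rule order_trans[OF bound mult_left_mono[OF sum_mono[OF B] K]])
    thus ?thesis by (simp add: sum_distrib_right mult.assoc)
  qed
  thus "bigo r (\<lambda>n. app T (s n))"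
    unfolding bigo_def by blast
qed

lemma is_local_bigo: "is_local T \<Longrightarrow> bigo r s \<Longrightarrow> bigo r (\<lambda>n. app T (s n))"
  by (simp add: is_local_def)

lemma is_local_finite: "is_local T \<Longrightarrow> finite {x. f x \<noteq> 0} \<Longrightarrow> finite {x. app T f x \<noteq> 0}"
  by (simp add: is_local_def)

lemma is_local_mult: "is_local S \<Longrightarrow> is_local T \<Longrightarrow> is_local (S * T)"
  by (simp add: is_local_def app_simps)

lemma is_local_add:
  assumes "is_local S" "is_local T" shows "is_local (S + T)"
  unfolding is_local_def app_simps
proof (intro conjI allI impI)
  fix f :: state
  assume f: "finite {x. f x \<noteq> 0}"
  have "{x. (app S f + app T f) x \<noteq> 0} \<subseteq> {x. app S f x \<noteq> 0} \<union> {x. app T f x \<noteq> 0}"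
    by auto
  thus "finite {x. (app S f + app T f) x \<noteq> 0}"
    by (rule finite_subset) (intro finite_UnI is_local_finite assms f)
qed (intro bigo_add is_local_bigo assms)

lemma is_local_diff:
  assumes "is_local S" "is_local T" shows "is_local (S - T)"
  unfolding is_local_def app_simps
proof (intro conjI allI impI)
  fix f :: state
  assume f: "finite {x. f x \<noteq> 0}"
  have "{x. (app S f - app T f) x \<noteq> 0} \<subseteq> {x. app S f x \<noteq> 0} \<union> {x. app T f x \<noteq> 0}"
    by auto
  thus "finite {x. (app S f - app T f) x \<noteq> 0}"
    by (rule finite_subset) (intro finite_UnI is_local_finite assms f)
qed (intro bigo_diff is_local_bigo assms)

lemma is_local_one: "is_local 1"
  by (simp add: is_local_def app_simps)

lemma is_local_wshift: "is_local (wshift c a)"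
  by (rule is_localI[of "{- a}" "cmod c"]) (simp_all add: wshift.rep_eq norm_smult)

lemma is_local_position: "is_local (position \<xi>)"
  unfolding is_local_def
proof (intro conjI allI impI)
  fix f :: state
  assume "finite {x. f x \<noteq> 0}"
  thus "finite {x. app (position \<xi>) f x \<noteq> 0}"
    by (rule rev_finite_subset) (auto simp: position.rep_eq)
next
  fix r :: "nat \<Rightarrow> real" and s :: "nat \<Rightarrow> state"
  assume "bigo r s"
  then obtain B where B: "\<And>x n. norm (s n x) \<le> B x * r n"
    unfolding bigo_def by metis
  have "norm (app (position \<xi>) (s n) x) \<le> (cmod (\<xi> x) * B x) * r n" for n x
    using mult_left_mono[OF B, of "cmod (\<xi> x)"]
    by (simp add: position.rep_eq norm_smult mult.assoc)
  thus "bigo r (\<lambda>n. app (position \<xi>) (s n))"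
    unfolding bigo_def by blast
qed

lemma norm_half_sum4_le:
  assumes "cmod a = cmod p" "cmod b = cmod q" "cmod c = cmod r" "cmod d = cmod s"
  shows "cmod ((a + b + c + d) / 2) \<le> (cmod p + cmod q + cmod r + cmod s) / 2"
  using norm_triangle_ineq[of "a + b + c" d] norm_triangle_ineq[of "a + b" c] norm_triangle_ineq[of a b] assms
  by (simp add: norm_divide)

lemma norm_half_combination_le:
  "cmod ((a + b + c + d) / 2) \<le> (cmod a + cmod b + cmod c + cmod d) / 2"
  "cmod ((a + \<i> * b - c - \<i> * d) / 2) \<le> (cmod a + cmod b + cmod c + cmod d) / 2"
  "cmod ((a - b + c - d) / 2) \<le> (cmod a + cmod b + cmod c + cmod d) / 2"
  "cmod ((a - \<i> * b - c + \<i> * d) / 2) \<le> (cmod a + cmod b + cmod c + cmod d) / 2"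
  using norm_half_sum4_le[of a a b b c c d d] norm_half_sum4_le[of a a "\<i> * b" b "- c" c "- (\<i> * d)" d]
    norm_half_sum4_le[of a a "- b" b c c "- d" d] norm_half_sum4_le[of a a "- (\<i> * b)" b "- c" c "\<i> * d" d]
  by (simp_all add: norm_mult)

lemma is_local_step: "is_local step"
proof (rule is_localI[of "{(-1, 0), (1, 0), (0, -1), (0, 1)}" 2])
  fix f :: state and x :: "int \<times> int"
  obtain a b where x: "x = (a, b)" by force
  have half: "(cmod (v $ 1) + cmod (v $ 2) + cmod (v $ 3) + cmod (v $ 4)) / 2 \<le> 2 * norm v"
    for v :: "complex ^ 4"
  proof -
    have "cmod (v $ 1) + cmod (v $ 2) + cmod (v $ 3) + cmod (v $ 4) \<le> norm v + norm v + norm v + norm v"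
      by (intro add_mono Finite_Cartesian_Product.norm_nth_le)
    thus ?thesis by simp
  qed
  have "cmod (app step f (a, b) $ 1) \<le> 2 * norm (f (a - 1, b))"
    "cmod (app step f (a, b) $ 2) \<le> 2 * norm (f (a + 1, b))"
    "cmod (app step f (a, b) $ 3) \<le> 2 * norm (f (a, b - 1))"
    "cmod (app step f (a, b) $ 4) \<le> 2 * norm (f (a, b + 1))"
    unfolding step_apply by (rule order_trans[OF norm_half_combination_le(1) half]
      order_trans[OF norm_half_combination_le(2) half] order_trans[OF norm_half_combination_le(3) half]
      order_trans[OF norm_half_combination_le(4) half])+
  thus "norm (app step f x) \<le> 2 * (\<Sum>a\<in>{(-1, 0), (1, 0), (0, -1), (0, 1)}. norm (f (x + a)))"
    using norm_vec4_le[of "app step f x"] by (simp add: x)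
qed auto

lemma is_local_unstep: "is_local unstep"
proof (rule is_localI[of "{(1, 0), (-1, 0), (0, 1), (0, -1)}" 2])
  fix f :: state and x :: "int \<times> int"
  obtain a b where x: "x = (a, b)" by force
  let ?N = "cmod (f (a + 1, b) $ 1) + cmod (f (a - 1, b) $ 2) + cmod (f (a, b + 1) $ 3) + cmod (f (a, b - 1) $ 4)"
  have "cmod (app unstep f (a, b) $ 1) \<le> ?N / 2" "cmod (app unstep f (a, b) $ 2) \<le> ?N / 2"
    "cmod (app unstep f (a, b) $ 3) \<le> ?N / 2" "cmod (app unstep f (a, b) $ 4) \<le> ?N / 2"
    unfolding unstep_apply
    using norm_half_combination_le[of "f (a + 1, b) $ 1" "f (a - 1, b) $ 2" "f (a, b + 1) $ 3" "f (a, b - 1) $ 4"]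
    by (simp_all add: algebra_simps)
  hence "norm (app unstep f x) \<le> 2 * ?N"
    using norm_vec4_le[of "app unstep f x"] unfolding x by linarith
  also have "?N \<le> norm (f (a + 1, b)) + norm (f (a - 1, b)) + norm (f (a, b + 1)) + norm (f (a, b - 1))"
    by (intro add_mono Finite_Cartesian_Product.norm_nth_le)
  finally show "norm (app unstep f x) \<le> 2 * (\<Sum>a\<in>{(1, 0), (-1, 0), (0, 1), (0, -1)}. norm (f (x + a)))"
    by (simp add: x)
qed auto

section \<open>Conservation of the square norm\<close>

lemma step_isometry:
  assumes "((\<lambda>x. (norm (f x))\<^sup>2) has_sum m) UNIV"
  shows "((\<lambda>x. (norm (app step f x))\<^sup>2) has_sum m) UNIV"
proof -
  \<comment> \<open>The mass in component \<open>k\<close> after the coin. The walk translates each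
    component separately, so the four total masses persist.\<close>
  define h where "h k x = (cmod ((F4 *v f x) $ k))\<^sup>2" for k :: 4 and x
  have total: "(norm (f x))\<^sup>2 = h 1 x + h 2 x + h 3 x + h 4 x" for x
    using norm_vec4_sq[of "F4 *v f x"] by (simp add: h_def norm_F4_mult)
  have "h k summable_on UNIV" for k
  proof (rule summable_on_comparison_test)
    show "(\<lambda>x. (norm (f x))\<^sup>2) summable_on UNIV" using assms by (rule has_sum_imp_summable)
    show "h k x \<le> (norm (f x))\<^sup>2" for x
      unfolding h_def by (metis Finite_Cartesian_Product.norm_nth_le norm_F4_mult norm_ge_zero power_mono)
  qed (simp add: h_def)
  hence h: "(h k has_sum infsum (h k) UNIV) UNIV" for k
    by (rule has_sum_infsum)
  have shift: "((\<lambda>x. h k (x - a)) has_sum infsum (h k) UNIV) UNIV" for k a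
  proof -
    have "bij (\<lambda>x. x - a)" by (rule bij_betw_byWitness[of _ "\<lambda>x. x + a"]) auto
    thus ?thesis using has_sum_reindex_bij_betw[of "\<lambda>x. x - a" UNIV UNIV "h k"] h by blast
  qed
  have "m = infsum (h 1) UNIV + infsum (h 2) UNIV + infsum (h 3) UNIV + infsum (h 4) UNIV"
    using assms unfolding total by (rule has_sum_unique) (intro has_sum_add h)
  moreover have "(norm (app step f x))\<^sup>2
      = h 1 (x - (1, 0)) + h 2 (x - (-1, 0)) + h 3 (x - (0, 1)) + h 4 (x - (0, -1))" for x
    by (cases x) (simp add: norm_vec4_sq h_def step.rep_eq walk_apply)
  ultimately show ?thesis
    by (auto intro!: has_sum_add shift)
qed

lemma step_power_isometry:
  assumes "((\<lambda>x. (norm (f x))\<^sup>2) has_sum m) UNIV"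
  shows "((\<lambda>x. (norm (app (step ^ n) f x))\<^sup>2) has_sum m) UNIV"
  using assms by (induction n) (simp_all add: app_simps step_isometry)

lemma sum_norm_sq_step_power_le:
  assumes "((\<lambda>x. (norm (f x))\<^sup>2) has_sum m) UNIV" "finite A"
  shows "(\<Sum>x\<in>A. (norm (app (step ^ n) f x))\<^sup>2) \<le> m"
  using step_power_isometry[OF assms(1), of n] assms(2)
  by (metis (mono_tags, lifting) finite_sum_le_has_sum subset_UNIV zero_le_power2)

lemma norm_step_power_le:
  assumes "((\<lambda>x. (norm (f x))\<^sup>2) has_sum m) UNIV"
  shows "norm (app (step ^ n) f x) \<le> sqrt m"
  using sum_norm_sq_step_power_le[OF assms, of "{x}" n] by (simp add: real_le_rsqrt)

lemma finite_support_has_sum: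
  assumes "finite {x. f x \<noteq> 0}"
  shows "((\<lambda>x. (norm (f x))\<^sup>2) has_sum (\<Sum>x | f x \<noteq> 0. (norm (f x))\<^sup>2)) UNIV"
proof -
  have "((\<lambda>x. (norm (f x))\<^sup>2) has_sum m) UNIV \<longleftrightarrow> ((\<lambda>x. (norm (f x))\<^sup>2) has_sum m) {x. f x \<noteq> 0}" for m
    by (rule has_sum_cong_neutral) auto
  thus ?thesis using has_sum_finite[OF assms] by blast
qed

lemma bigo_step_power:
  assumes "finite {x. f x \<noteq> 0}"
  shows "bigo (\<lambda>_. 1) (\<lambda>n. app (step ^ n) f)"
  unfolding bigo_def using norm_step_power_le[OF finite_support_has_sum[OF assms]] by auto

text \<open>The telescoped identity equates \<open>Suc n\<close> copies of the \<open>px\<close>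
  term with terms in which a power of \<open>step\<close> acts on a finitely supported state,
  possibly followed by a local operator; the isometry bounds these at each site.\<close>

lemma commutator_decay:
  assumes q: "inverse_pair_relation step unstep (position \<xi>) (wshift \<i> (0, 0)) walk_e2 walk_tr de dt"
    and de: "is_local de" and dt: "is_local dt" and f: "finite {x. f x \<noteq> 0}"
  shows "bigo (\<lambda>n. 1 / real (Suc n)) (\<lambda>n. app (de - dt * (step - unstep)) (app (step ^ n) f))"
proof -
  interpret inverse_pair_relation step unstep "position \<xi>" "wshift \<i> (0, 0)" walk_e2 walk_tr de dt by (rule q)
  note local_intros = is_local_mult is_local_add is_local_diff is_local_one is_local_wshift is_local_position
    is_local_step is_local_unstep
  have lB: "is_local B" unfolding B_def by (intro local_intros)
  have l_tr: "is_local walk_tr" unfolding walk_tr_def by (intro local_intros)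
  have lW: "is_local W" unfolding W_def by (intro local_intros lB l_tr)
  have ldp: "is_local dp" unfolding dp_def by (intro local_intros l_tr)
  let ?s = "\<lambda>n. app (step ^ Suc n) (app W f) - app W (app (step ^ Suc n) f)
    - (app (position \<xi>) (app (step ^ Suc n) (app dp f)) - app (step ^ Suc n) (app (position \<xi>) (app dp f)))"
  have bd: "bigo (\<lambda>_. 1) (\<lambda>n. app (step ^ Suc n) g)" if "finite {x. g x \<noteq> 0}" for g
    using bigo_step_power[OF that] unfolding bigo_def by blast
  have "bigo (\<lambda>_. 1) ?s"
    by (intro bigo_diff bd is_local_bigo is_local_finite lW ldp is_local_position f)
  moreover have "norm (?s n x) = real (Suc n) * norm (app px (app (step ^ n) f) x)" for n x
  proof -
    have "(\<Sum>k\<le>n. px * step ^ n) = step ^ Suc n * W - W * step ^ Suc n - (position \<xi> * step ^ Suc n - step ^ Suc n * position \<xi>) * dp"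
      using commutator_power[of n] by (simp add: algebra_simps)
    hence "app (\<Sum>k\<le>n. px * step ^ n) f = app (step ^ Suc n * W - W * step ^ Suc n - (position \<xi> * step ^ Suc n - step ^ Suc n * position \<xi>) * dp) f"
      by simp
    hence "(\<Sum>k\<le>n. app px (app (step ^ n) f)) = ?s n"
      unfolding app_sum app_simps .
    hence "?s n x = (\<Sum>k\<le>n. app px (app (step ^ n) f)) x" by simp
    also have "\<dots> = (\<Sum>k\<le>n. app px (app (step ^ n) f) x)"
      by (induction n) simp_all
    also have "\<dots> = real (Suc n) *\<^sub>R app px (app (step ^ n) f) x"
      by (simp only: sum_constant_scaleR card_atMost)
    finally show ?thesis by simp
  qed
  ultimately show ?thesis
    unfolding bigo_def px_def[symmetric] by (simp add: field_simps)
qed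

text \<open>With unit shifts \<open>x\<close>, \<open>y\<close>:
  \<open>x + y - i (1/x + 1/y) = (x + y) (1 - i / (x y))\<close> and
  \<open>x/y - y/x = (x/y) (1 - y^2 / x^2)\<close>.\<close>

lemma symbol_factorization:
  "(wshift (1 / 2) (0, 1) + wshift (- \<i> / 2) (0, -1) + (wshift (1 / 2) (1, 0) + wshift (- \<i> / 2) (-1, 0)))
     * (wshift ((\<i> - 1) / 4) (1, -1) + wshift ((1 - \<i>) / 4) (-1, 1))
   = wshift ((\<i> - 1) / 8) (2, -1)
     * ((1 - wshift 1 (-2, 2)) * ((1 - wshift (-1) (-1, 1)) * (1 - wshift \<i> (-1, -1))))"
  by (rule endo_eqI) (simp add: app_simps wshift.rep_eq vec_eq_iff field_simps)

lemma bigo_factor_decay: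
  assumes f: "finite {x. f x \<noteq> 0}"
  shows "bigo (\<lambda>n. 1 / real (Suc n)) (\<lambda>n. app
    ((1 - wshift 1 (-2, 2)) * ((1 - wshift (-1) (-1, 1)) * (1 - wshift \<i> (-1, -1)))) (app (step ^ n) f))"
    (is "bigo _ (\<lambda>n. app ?R _)")
proof -
  note local_intros = is_local_add is_local_diff is_local_wshift
  let ?c = "(\<i> - 1) / 4"
  define de where "de \<xi> = wshift (\<xi> (1, -1) * ?c) (1, -1) + wshift (\<xi> (-1, 1) * ?c) (-1, 1)" for \<xi> :: "int \<times> int \<Rightarrow> complex"
  define dt where "dt \<xi> = wshift (\<xi> (1, 0) / 2) (1, 0) + wshift (\<xi> (-1, 0) * \<i> / 2) (-1, 0)
    + wshift (\<xi> (0, 1) / 2) (0, 1) + wshift (\<xi> (0, -1) * \<i> / 2) (0, -1)" for \<xi> :: "int \<times> int \<Rightarrow> complex"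
  define \<xi>1 \<xi>2 :: "int \<times> int \<Rightarrow> complex" where "\<xi>1 x = of_int (fst x)" and "\<xi>2 x = of_int (snd x)" for x
  have q: "inverse_pair_relation step unstep (position \<xi>1) (wshift \<i> (0, 0)) walk_e2 walk_tr (de \<xi>1) (dt \<xi>1)"
    "inverse_pair_relation step unstep (position \<xi>2) (wshift \<i> (0, 0)) walk_e2 walk_tr (de \<xi>2) (dt \<xi>2)"
    unfolding de_def dt_def by (rule inverse_pair_relation_walk; simp add: \<xi>1_def \<xi>2_def)+
  have loc: "is_local (de \<xi>)" "is_local (dt \<xi>)" for \<xi>
    unfolding de_def dt_def by (intro local_intros)+
  have comm: "dt \<xi>2 * dt \<xi>1 = dt \<xi>1 * dt \<xi>2"
    unfolding dt_def by (simp add: \<xi>1_def \<xi>2_def algebra_simps wshift_mult wshift_0)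
  \<comment> \<open>Cross-multiplication by the commuting \<open>dt\<close> coefficients eliminates
    \<open>step - unstep\<close>.\<close>
  have "dt \<xi>2 * (de \<xi>1 - dt \<xi>1 * (step - unstep)) - dt \<xi>1 * (de \<xi>2 - dt \<xi>2 * (step - unstep)) = dt \<xi>2 * de \<xi>1 - dt \<xi>1 * de \<xi>2"
    using comm_left[OF comm] by (simp add: algebra_simps)
  also have "\<dots> = (dt \<xi>2 + dt \<xi>1) * de \<xi>1"
  proof -
    \<comment> \<open>Every exponent in \<open>walk_e2\<close> has coordinate sum zero.\<close>
    have "de \<xi>2 = - de \<xi>1"
      unfolding de_def by (simp add: \<xi>1_def \<xi>2_def wshift_uminus minus_divide_left)
    thus ?thesis by (simp add: algebra_simps)
  qed
  also have "\<dots> = wshift ((\<i> - 1) / 8) (2, -1) * ?R"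
    unfolding symbol_factorization[symmetric]
    by (simp add: de_def dt_def wshift_0 \<xi>1_def \<xi>2_def)
  finally have eq: "dt \<xi>2 * (de \<xi>1 - dt \<xi>1 * (step - unstep)) - dt \<xi>1 * (de \<xi>2 - dt \<xi>2 * (step - unstep))
      = wshift ((\<i> - 1) / 8) (2, -1) * ?R" .
  \<comment> \<open>The leading monomial is invertible, so it can be stripped off.\<close>
  have inv: "wshift (8 / (\<i> - 1)) (-2, 1) * wshift ((\<i> - 1) / 8) (2, -1) = 1"
  proof -
    have "\<i> - 1 \<noteq> 0" by (simp add: complex_eq_iff)
    hence c: "8 / (\<i> - 1) * ((\<i> - 1) / 8) = 1" by simp
    show ?thesis
      unfolding wshift_mult c by (rule endo_eqI) (simp add: app_simps wshift.rep_eq)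
  qed
  have R: "?R = wshift (8 / (\<i> - 1)) (-2, 1) *
      (dt \<xi>2 * (de \<xi>1 - dt \<xi>1 * (step - unstep)) - dt \<xi>1 * (de \<xi>2 - dt \<xi>2 * (step - unstep)))"
    unfolding eq by (simp add: inv flip: mult.assoc)
  show ?thesis
    unfolding R app_simps(2,3)
    by (intro is_local_bigo bigo_diff is_local_wshift loc commutator_decay[OF q(1), unfolded app_simps(2,3)]
        commutator_decay[OF q(2), unfolded app_simps(2,3)] f)
qed

subsection \<open>Cancelling the factors\<close>

definition l2_bounded :: "(nat \<Rightarrow> state) \<Rightarrow> bool" where
  "l2_bounded s \<longleftrightarrow> (\<exists>m. \<forall>n A. finite A \<longrightarrow> (\<Sum>x\<in>A. (norm (s n x))\<^sup>2) \<le> m)"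

text \<open>Factors are cancelled one at a time, so the intermediate sequences must stay bounded
  too.\<close>

lemma l2_bounded_factor:
  assumes "l2_bounded s" "cmod w = 1"
  shows "l2_bounded (\<lambda>n. app (1 - wshift w a) (s n))"
proof -
  obtain m where m: "\<And>n A. finite A \<Longrightarrow> (\<Sum>x\<in>A. (norm (s n x))\<^sup>2) \<le> m"
    using assms(1) unfolding l2_bounded_def by blast
  have "(\<Sum>x\<in>A. (norm (app (1 - wshift w a) (s n) x))\<^sup>2) \<le> 2 * m + 2 * m" if "finite A" for n A
  proof -
    have *: "(norm (app (1 - wshift w a) (s n) x))\<^sup>2 \<le> 2 * (norm (s n x))\<^sup>2 + 2 * (norm (s n (x - a)))\<^sup>2" for x
    proof -
      have "norm (app (1 - wshift w a) (s n) x) \<le> norm (s n x) + norm (s n (x - a))"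
        using norm_triangle_ineq4[of "s n x" "w *s s n (x - a)"]
        by (simp add: app_simps wshift.rep_eq norm_smult assms(2))
      hence "(norm (app (1 - wshift w a) (s n) x))\<^sup>2 \<le> (norm (s n x) + norm (s n (x - a)))\<^sup>2"
        by (rule power_mono) simp
      also have "\<dots> \<le> 2 * (norm (s n x))\<^sup>2 + 2 * (norm (s n (x - a)))\<^sup>2"
        using zero_le_power2[of "norm (s n x) - norm (s n (x - a))"]
        by (simp add: power2_eq_square algebra_simps)
      finally show ?thesis .
    qed
    have "(\<Sum>x\<in>A. (norm (s n (x - a)))\<^sup>2) = (\<Sum>x\<in>(\<lambda>x. x - a) ` A. (norm (s n x))\<^sup>2)"
      by (subst sum.reindex) (simp_all add: inj_on_def)
    also have "\<dots> \<le> m" using m that by simp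
    finally have "(\<Sum>x\<in>A. (norm (s n (x - a)))\<^sup>2) \<le> m" .
    moreover have "(\<Sum>x\<in>A. (norm (app (1 - wshift w a) (s n) x))\<^sup>2)
        \<le> 2 * (\<Sum>x\<in>A. (norm (s n x))\<^sup>2) + 2 * (\<Sum>x\<in>A. (norm (s n (x - a)))\<^sup>2)"
      using sum_mono[of A, OF *] by (simp add: sum.distrib sum_distrib_left)
    ultimately show ?thesis using m[OF that, of n] by linarith
  qed
  thus ?thesis unfolding l2_bounded_def by blast
qed

text \<open>For large \<open>n\<close> the values along the line \<open>x - k a\<close> have nearly
  equal modulus, so a value at \<open>x\<close> that stays away from zero would give arbitrarily
  many large values and break the bound.\<close>

lemma l2_bounded_tendsto_zero:
  assumes s: "l2_bounded s" and w: "cmod w = 1" and a: "a \<noteq> 0"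
    and lim: "\<And>x. (\<lambda>n. app (1 - wshift w a) (s n) x) \<longlonglongrightarrow> 0"
  shows "(\<lambda>n. s n x) \<longlonglongrightarrow> 0"
proof -
  obtain m where m: "\<And>n A. finite A \<Longrightarrow> (\<Sum>x\<in>A. (norm (s n x))\<^sup>2) \<le> m"
    using s unfolding l2_bounded_def by blast
  define p where "p k = (fst x - int k * fst a, snd x - int k * snd a)" for k
  have inj: "inj p"
    using a by (auto simp: inj_def p_def prod_eq_iff)
  have p_Suc: "p (Suc k) = p k - a" for k
    by (cases a) (simp add: p_def algebra_simps)
  have lim_p: "(\<lambda>n. s n x - w ^ k *s s n (p k)) \<longlonglongrightarrow> 0" for k
  proof (induction k)
    case 0
    show ?case by (simp add: p_def)
  next
    case (Suc k)
    have "(\<lambda>n. w ^ k *s app (1 - wshift w a) (s n) (p k)) \<longlonglongrightarrow> 0"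
      using lim[of "p k"] by (subst tendsto_norm_zero_iff[symmetric]) (simp add: norm_smult norm_power w tendsto_norm_zero)
    hence "(\<lambda>n. (s n x - w ^ k *s s n (p k)) + w ^ k *s app (1 - wshift w a) (s n) (p k)) \<longlonglongrightarrow> 0"
      using tendsto_add[OF Suc.IH] by fastforce
    thus ?case
      by (simp add: app_simps wshift.rep_eq p_Suc vector_ssub_ldistrib vector_smult_assoc mult.commute)
  qed
  show ?thesis
    unfolding LIMSEQ_iff
  proof (intro allI impI)
    \<comment> \<open>\<open>N\<close> sites of modulus at least \<open>r / 2\<close> already carry
      more than the mass \<open>m\<close>.\<close>
    fix r :: real assume r: "r > 0"
    obtain N where N: "m / (r / 2)\<^sup>2 < real N" using reals_Archimedean2 by blast
    have "\<forall>\<^sub>F n in sequentially. \<forall>k\<in>{..<N}. norm (s n x - w ^ k *s s n (p k)) < r / 2"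
      by (rule eventually_ball_finite) (use lim_p half_gt_zero[OF r] in \<open>auto simp only: tendsto_iff dist_norm diff_zero finite_lessThan\<close>)
    then obtain n0 where n0: "\<And>n k. n \<ge> n0 \<Longrightarrow> k < N \<Longrightarrow> norm (s n x - w ^ k *s s n (p k)) < r / 2"
      unfolding eventually_sequentially by auto
    have "norm (s n x) < r" if n: "n \<ge> n0" for n
    proof (rule ccontr)
      assume "\<not> norm (s n x) < r"
      hence big: "r / 2 \<le> norm (s n (p k))" if "k < N" for k
        using n0[OF n that] norm_triangle_ineq2[of "s n x" "w ^ k *s s n (p k)"]
        by (simp add: norm_smult norm_power w)
      have "real N * (r / 2)\<^sup>2 = (\<Sum>k<N. (r / 2)\<^sup>2)" by simp
      also have "\<dots> \<le> (\<Sum>k<N. (norm (s n (p k)))\<^sup>2)"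
        using big r by (intro sum_mono power_mono) auto
      also have "\<dots> = (\<Sum>y\<in>p ` {..<N}. (norm (s n y))\<^sup>2)"
        by (subst sum.reindex) (use inj in \<open>auto simp: inj_on_def inj_def\<close>)
      also have "\<dots> \<le> m" by (rule m) simp
      finally show False using N r by (simp add: field_simps)
    qed
    thus "\<exists>no. \<forall>n\<ge>no. norm (s n x - 0) < r" by auto
  qed
qed

text \<open>The commutator estimate makes \<open>?s3\<close> decay; the factors are then peeled off
  from the outermost inwards.\<close>

lemma step_power_tendsto_zero:
  assumes f: "finite {x. f x \<noteq> 0}"
  shows "(\<lambda>n. app (step ^ n) f x) \<longlonglongrightarrow> 0"
proof -
  let ?a1 = "(-1, -1) :: int \<times> int" and ?a2 = "(-1, 1) :: int \<times> int" and ?a3 = "(-2, 2) :: int \<times> int"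
  let ?s0 = "\<lambda>n. app (step ^ n) f"
  let ?s1 = "\<lambda>n. app (1 - wshift \<i> ?a1) (?s0 n)"
  let ?s2 = "\<lambda>n. app (1 - wshift (-1) ?a2) (?s1 n)"
  let ?s3 = "\<lambda>n. app (1 - wshift 1 ?a3) (?s2 n)"
  have b0: "l2_bounded ?s0"
    unfolding l2_bounded_def using sum_norm_sq_step_power_le[OF finite_support_has_sum[OF f]] by blast
  have b1: "l2_bounded ?s1" by (rule l2_bounded_factor[OF b0]) simp
  have b2: "l2_bounded ?s2" by (rule l2_bounded_factor[OF b1]) simp
  have s3: "(\<lambda>n. ?s3 n y) \<longlonglongrightarrow> 0" for y
  proof -
    obtain C where C: "\<And>n. norm (?s3 n y) \<le> C * (1 / real (Suc n))"
      using bigo_factor_decay[OF f] unfolding bigo_def app_simps(3) by blast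
    have "(\<lambda>n. C * (1 / real (Suc n))) \<longlonglongrightarrow> 0"
      using tendsto_mult_right_zero[OF LIMSEQ_inverse_real_of_nat] by (simp add: inverse_eq_divide)
    thus ?thesis by (rule Lim_null_comparison[rotated]) (use C in simp)
  qed
  have s2: "(\<lambda>n. ?s2 n y) \<longlonglongrightarrow> 0" for y
    by (rule l2_bounded_tendsto_zero[OF b2 _ _ s3]) (simp_all add: zero_prod_def)
  have s1: "(\<lambda>n. ?s1 n y) \<longlonglongrightarrow> 0" for y
    by (rule l2_bounded_tendsto_zero[OF b1 _ _ s2]) (simp_all add: zero_prod_def)
  show ?thesis
    by (rule l2_bounded_tendsto_zero[OF b0 _ _ s1]) (simp_all add: zero_prod_def)
qed

text \<open>Powers of \<open>step\<close> preserve the modulus of an eigenvector at each site, yet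
  its finitely supported truncations decay there and the remaining tail has small norm.\<close>

lemma step_no_eigenvector:
  assumes "l2 f" "app step f = (\<lambda>x. c *s f x)"
  shows "f x = 0"
proof (rule ccontr)
  assume fx: "f x \<noteq> 0"
  obtain m where m: "((\<lambda>x. (norm (f x))\<^sup>2) has_sum m) UNIV"
    using assms(1) unfolding l2_def summable_on_def by blast
  have "m > 0"
    using sum_norm_sq_step_power_le[OF m, of "{x}" 0] fx
    by (simp add: app_simps less_le_trans[of 0 "(norm (f x))\<^sup>2"])
  have "((\<lambda>x. (norm (c *s f x))\<^sup>2) has_sum m) UNIV"
    using step_isometry[OF m] assms(2) by simp
  moreover have "((\<lambda>x. (norm (c *s f x))\<^sup>2) has_sum (cmod c)\<^sup>2 * m) UNIV"
    using has_sum_cmult_right[OF m, of "(cmod c)\<^sup>2"] by (simp add: norm_smult power_mult_distrib)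
  \<comment> \<open>The isometry forces the eigenvalue onto the unit circle.\<close>
  ultimately have "m = (cmod c)\<^sup>2 * m" by (rule has_sum_unique)
  hence "(cmod c)\<^sup>2 = 1" using \<open>m > 0\<close> by simp
  hence c: "cmod c = 1" using power2_eq_iff_nonneg[of "cmod c" 1] by simp
  have pow: "app (step ^ n) f y = c ^ n *s f y" for n y
  proof (induction n arbitrary: y)
    case (Suc n)
    \<comment> \<open>An \<open>endo\<close> is only additive; complex homogeneity comes from
      commuting with the monomial of exponent 0.\<close>
    have "app step (\<lambda>y. c ^ n *s f y) = (\<lambda>y. c ^ n *s app step f y)"
      using arg_cong[OF wshift_step[of "c ^ n" 0], of "\<lambda>T. app T f"] by (simp add: app_simps wshift.rep_eq)
    moreover have "app (step ^ n) f = (\<lambda>y. c ^ n *s f y)" using Suc.IH by blast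
    ultimately show ?case by (simp add: app_simps assms(2) vector_smult_assoc mult.commute)
  qed (simp add: app_simps)
  \<comment> \<open>The tail outside \<open>A\<close> then has squared norm at most
    \<open>e\<close>, hence contributes at most half of \<open>norm (f x)\<close> for every
    \<open>n\<close>.\<close>
  define e where "e = (norm (f x) / 2)\<^sup>2"
  have "e > 0" using fx by (simp add: e_def)
  obtain A where A: "finite A" "dist (\<Sum>x\<in>A. (norm (f x))\<^sup>2) m \<le> e"
    using has_sum_finite_approximation[OF m \<open>e > 0\<close>] by blast
  define g where "g y = (if y \<in> A then f y else 0)" for y
  define h where "h y = (if y \<in> A then 0 else f y)" for y
  have fgh: "f = g + h" by (auto simp: g_def h_def)
  have g: "finite {y. g y \<noteq> 0}"
    by (rule finite_subset[OF _ A(1)]) (auto simp: g_def)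
  have "((\<lambda>y. (norm (f y))\<^sup>2) has_sum (m - (\<Sum>x\<in>A. (norm (f x))\<^sup>2))) (UNIV - A)"
    by (rule has_sum_Diff[OF m has_sum_finite[OF A(1)]]) simp
  hence h: "((\<lambda>y. (norm (h y))\<^sup>2) has_sum (m - (\<Sum>x\<in>A. (norm (f x))\<^sup>2))) UNIV"
    by (subst has_sum_cong_neutral[where T = "UNIV - A" and g = "\<lambda>y. (norm (f y))\<^sup>2"]) (auto simp: h_def)
  have "norm (f x) \<le> norm (app (step ^ n) g x) + norm (f x) / 2" for n
  proof -
    have "norm (f x) = norm (app (step ^ n) f x)" by (simp add: pow norm_smult norm_power c)
    also have "\<dots> \<le> norm (app (step ^ n) g x) + norm (app (step ^ n) h x)"
      using norm_triangle_ineq[of "app (step ^ n) g x" "app (step ^ n) h x"]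
      by (simp add: fgh app_add)
    also have "norm (app (step ^ n) h x) \<le> sqrt (m - (\<Sum>x\<in>A. (norm (f x))\<^sup>2))"
      by (rule norm_step_power_le[OF h])
    also have "\<dots> \<le> sqrt e" using A(2) by (simp add: dist_real_def)
    also have "\<dots> = norm (f x) / 2" by (simp add: e_def)
    finally show ?thesis by simp
  qed
  hence "norm (f x) / 2 \<le> norm (app (step ^ n) g x)" for n
    by (simp add: field_simps)
  moreover have "(\<lambda>n. norm (app (step ^ n) g x)) \<longlonglongrightarrow> 0"
    by (rule tendsto_norm_zero[OF step_power_tendsto_zero[OF g]])
  ultimately have "norm (f x) / 2 \<le> 0"
    by (intro LIMSEQ_le_const) auto
  thus False using fx by simp
qed

subsection \<open>The Fourier walk\<close>

lemma funpow_walk: "(walk F4 ^^ n) f = app (step ^ n) f"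
  by (induction n) (simp_all add: app_simps step.rep_eq)

theorem mainTheorem1:
  shows "(\<forall>c. \<not> eigenvalue (walk F4) c) \<and>
         (\<forall>\<phi> :: complex ^ 4. \<forall>x :: int \<times> int. norm \<phi> = 1 \<longrightarrow>
            (\<lambda>n. pn (walk F4) n \<phi> x) \<longlonglongrightarrow> 0)"
proof (intro conjI allI impI notI)
  fix c assume "eigenvalue (walk F4) c"
  then obtain f where "l2 f" "f \<noteq> (\<lambda>_. 0)" "app step f = (\<lambda>x. c *s f x)"
    unfolding eigenvalue_def step.rep_eq by blast
  thus False using step_no_eigenvector by blast
next
  fix \<phi> :: "complex ^ 4" and x :: "int \<times> int"
  have "{y. delta0 \<phi> y \<noteq> 0} \<subseteq> {(0, 0)}" by (auto simp: delta0_def)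
  hence "finite {y. delta0 \<phi> y \<noteq> 0}" by (rule finite_subset) simp
  from tendsto_power[OF tendsto_norm_zero[OF step_power_tendsto_zero[OF this, of x]], of 2]
  show "(\<lambda>n. pn (walk F4) n \<phi> x) \<longlonglongrightarrow> 0"
    by (simp add: pn_def funpow_walk)
qed

end
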